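(* For every positive integer $n$, let $p\in\{0,1\}^k$ be the binary expansion of $n$ (so $p[1]=1$ and $k=\lfloor \log_2 n\rfloor+1$). Then $|a[1,n]|_{pal}$ equals the minimal number of masque operations of type $A$ of length $k$ whose successive application transforms $p$ into the word $0^k$. As a result, $|a[1,n]|_{pal}=c[n]$.
   Context: The ruler sequence $(a[n])_{n\ge 1}$ is defined by $a[n]=$ the exponent of the highest power of $2$ dividing $n$ (the $2$-adic valuation of $n$); its first terms are $0,1,0,2,0,1,0,3,\dots$. For a word $x$ and $i\le j$, $x[i,j]=x[i]x[i+1]\cdots x[j]$. A word $w$ is a palindrome if it equals its reversal; $|w|_{pal}$ is the minimal $m$ such that $w=w_1w_2\cdots w_m$ with every $w_i$ a palindrome (the palindromic length). For a positive integer $n$, $c[n]$ is the number of runs (maximal blocks of equal consecutive letters) in the binary expansion of $n$; e.g. $1000=(11111)(0)(1)(000)_2$ gives $c[1000]=4$. For $0\le t\le k$, the masque of type $A$ of length $k$ is the binary word $M^A_k(t)=0^t1^{k-t}$, and the associated masque operation $M^A_k(t):\{0,1\}^k\to\{0,1\}^k$ maps a word $q$ to the word whose $i$-th letter is $q[i]$ if $M^A_k(t)[i]=0$ and $1-q[i]$ if $M^A_k(t)[i]=1$ (i.e. it complements the letters in positions $t+1,\dots,k$). *)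

theory Defs
  imports Complex_Main "HOL-Computational_Algebra.Computational_Algebra"
begin

text \<open>
  Finite words are lists. The letters of binary words are of type \<^typ>\<open>bool\<close>, where
  \<^const>\<open>False\<close> stands for 0 and \<^const>\<open>True\<close> for 1. List positions are counted from 0, so the
  letter at position \<open>i\<close> (counted from 1) of a word \<open>w\<close> is \<open>w ! (i - 1)\<close>.
\<close>

definition ruler :: "nat \<Rightarrow> nat" where
  "ruler n = multiplicity 2 n"

definition factor :: "(nat \<Rightarrow> 'a) \<Rightarrow> nat \<Rightarrow> nat \<Rightarrow> 'a list" where
  "factor x i j = map x [i..<Suc j]"

definition palindrome :: "'a list \<Rightarrow> bool" where
  "palindrome w \<longleftrightarrow> rev w = w"

text \<open>Empty factors are not excluded; they cannot occur in a shortest factorization.\<close>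

definition pal_length :: "'a list \<Rightarrow> nat" where
  "pal_length w =
     (LEAST m. \<exists>ws. length ws = m \<and> (\<forall>u \<in> set ws. palindrome u) \<and> concat ws = w)"

text \<open>The most significant digit comes first.\<close>

definition binary_expansion :: "nat \<Rightarrow> bool list" where
  "binary_expansion n = map (bit n) (rev [0..<nat \<lfloor>log 2 (real n)\<rfloor> + 1])"

text \<open>A run of \<open>w\<close> is represented by the pair of its first and last position.\<close>

definition runs :: "'a list \<Rightarrow> (nat \<times> nat) set" where
  "runs w = {(i, j). i \<le> j \<and> j < length w \<and> (\<forall>l \<in> {i..j}. w ! l = w ! i) \<and>
               (0 < i \<longrightarrow> w ! (i - 1) \<noteq> w ! i) \<and>
               (j + 1 < length w \<longrightarrow> w ! (j + 1) \<noteq> w ! j)}"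

definition binary_runs :: "nat \<Rightarrow> nat" where
  "binary_runs n = card (runs (binary_expansion n))"

definition masque_A :: "nat \<Rightarrow> nat \<Rightarrow> bool list" where
  "masque_A k t = replicate t False @ replicate (k - t) True"

definition apply_masque :: "bool list \<Rightarrow> bool list \<Rightarrow> bool list" where
  "apply_masque M q = map2 (\<lambda>c b. if c then \<not> b else b) M q"

definition min_masques_A :: "nat \<Rightarrow> bool list \<Rightarrow> nat" where
  "min_masques_A k p =
     (LEAST m. \<exists>ts. length ts = m \<and> set ts \<subseteq> {0..k} \<and>
        fold (\<lambda>t. apply_masque (masque_A k t)) ts p = replicate k False)"

text \<open>The sets whose least elements are taken above are not empty.\<close>

lemma pal_factorization_exists:
  "\<exists>ws. length ws = length w \<and> (\<forall>u \<in> set ws. palindrome u) \<and> concat ws = w"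
  by (rule exI[of _ "map (\<lambda>a. [a]) w"]) (auto simp: palindrome_def)

lemma length_apply_masque_A:
  assumes "t \<le> k" "length q = k"
  shows "length (apply_masque (masque_A k t) q) = k"
  using assms by (simp add: apply_masque_def masque_A_def)

lemma nth_apply_masque_A:
  assumes "t \<le> k" "length q = k" "i < k"
  shows "apply_masque (masque_A k t) q ! i \<longleftrightarrow> (if i < t then q ! i else \<not> q ! i)"
  using assms by (auto simp: apply_masque_def masque_A_def nth_append)

lemma masques_A_exist:
  assumes "length p = k"
  shows "\<exists>ts. set ts \<subseteq> {0..k} \<and> fold (\<lambda>t. apply_masque (masque_A k t)) ts p = replicate k False"
proof -
  let ?op = "\<lambda>t. apply_masque (masque_A k t)"
  have "\<exists>ts. set ts \<subseteq> {0..k} \<and> length (fold ?op ts p) = k \<and> (\<forall>i<j. \<not> fold ?op ts p ! i)"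
    if "j \<le> k" for j
    using that
  proof (induction j)
    case 0
    show ?case
      using assms by (intro exI[of _ "[]"]) simp
  next
    case (Suc j)
    then obtain ts where ts: "set ts \<subseteq> {0..k}" "length (fold ?op ts p) = k"
        "\<forall>i<j. \<not> fold ?op ts p ! i"
      by auto
    show ?case
    proof (cases "fold ?op ts p ! j")
      case False
      then show ?thesis
        using ts by (intro exI[of _ ts]) (auto simp: less_Suc_eq)
    next
      case True
      then show ?thesis
        using ts Suc.prems
        by (intro exI[of _ "ts @ [j]"])
           (auto simp: less_Suc_eq length_apply_masque_A nth_apply_masque_A)
    qed
  qed
  from this[of k] obtain ts where ts: "set ts \<subseteq> {0..k}" "length (fold ?op ts p) = k"
      "\<forall>i<k. \<not> fold ?op ts p ! i"
    by blast
  then have "fold ?op ts p = replicate k False"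
    by (intro nth_equalityI) simp_all
  with ts(1) show ?thesis
    by blast
qed

text \<open>
  The word \<^term>\<open>binary_expansion n\<close> is the binary expansion of \<open>n\<close> without leading zeros.
\<close>

lemma length_binary_expansion: "length (binary_expansion n) = nat \<lfloor>log 2 (real n)\<rfloor> + 1"
  by (simp add: binary_expansion_def)

lemma binary_expansion_correct:
  assumes "n > 0"
  shows "hd (binary_expansion n)" "horner_sum of_bool 2 (rev (binary_expansion n)) = n"
proof -
  define m where "m = nat \<lfloor>log 2 (real n)\<rfloor>"
  have "\<lfloor>log 2 (real n)\<rfloor> = int m"
    using assms by (simp add: m_def)
  then have "2 ^ m \<le> n" "n < 2 ^ (m + 1)"
    using assms floor_log_nat_eq_powr_iff[of 2 n m] by simp_all
  then have "n div 2 ^ m = 1"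
    by (intro div_nat_eqI) simp_all
  then show "hd (binary_expansion n)"
    by (simp add: binary_expansion_def m_def[symmetric] bit_iff_odd)
  have "rev (binary_expansion n) = map (bit n) [0..<m + 1]"
    by (simp only: binary_expansion_def m_def[symmetric] rev_map rev_rev_ident)
  then have "horner_sum of_bool 2 (rev (binary_expansion n)) = take_bit (m + 1) n"
    by (simp only: horner_sum_bit_eq_take_bit)
  also have "\<dots> = n"
    using \<open>n < 2 ^ (m + 1)\<close> by (simp only: take_bit_eq_mod mod_less)
  finally show "horner_sum of_bool 2 (rev (binary_expansion n)) = n" .
qed

end

theory Submission
  imports Defs
begin

text \<open>
  A factor \<open>a[i+1,j]\<close> of the ruler sequence with \<open>i < j\<close> is a palindrome iff it has a centre
  \<open>2\<^sup>m s\<close> with \<open>s\<close> odd and extends by less than \<open>2\<^sup>m\<close> to both sides. Then the binary expansions of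
  \<open>i\<close> and \<open>j\<close> are obtained from each other by complementing the \<open>m + 1\<close> lowest digits. So deleting
  a palindromic suffix is a masque operation, and both kinds of operations change exactly one of the
  relations ``adjacent digits are different'', where the expansion is preceded by a zero. Conversely,
  deleting the palindrome centred at the largest power of 2 up to \<open>n\<close> removes the first such change.
\<close>

section \<open>Changes of digits in words\<close>

text \<open>For \<open>t = 0\<close> the conjunction is false, so the first letter is compared with
  a virtual 0 in front of the word. Nothing is compared across the right end.\<close>

definition changes :: "bool list \<Rightarrow> nat set" where
  "changes q = {t. t < length q \<and> q ! t \<noteq> (0 < t \<and> q ! (t - 1))}"

lemma finite_changes [simp]: "finite (changes q)"
  by (simp add: changes_def)

text \<open>Two adjacent letters are both kept or both complemented, except across the left border
  of the complemented suffix. For \<open>t = k\<close> the suffix is empty, and \<open>j < k\<close>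
  rules out \<open>j = t\<close>.\<close>

lemma changes_apply_masque_A:
  assumes "t \<le> k" "length q = k"
  shows "j \<in> changes (apply_masque (masque_A k t) q) \<longleftrightarrow> j < k \<and> (j \<in> changes q) \<noteq> (j = t)"
proof (cases "j < k")
  case True
  then show ?thesis
    using assms by (auto simp: changes_def length_apply_masque_A nth_apply_masque_A)
next
  case False
  then show ?thesis
    using length_apply_masque_A[OF assms] by (simp add: changes_def)
qed

lemma changes_empty_iff: "changes q = {} \<longleftrightarrow> q = replicate (length q) False"
proof
  assume *: "changes q = {}"
  have "\<not> q ! t" if "t < length q" for t
    using that
  proof (induction t)
    case 0
    have "0 \<notin> changes q" using * by simp
    with 0 show ?case by (simp add: changes_def)
  next
    case (Suc t)
    have "Suc t \<notin> changes q" using * by simp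
    with Suc show ?case by (simp add: changes_def)
  qed
  then show "q = replicate (length q) False"
    by (intro nth_equalityI) auto
next
  assume "q = replicate (length q) False"
  then have "\<not> q ! t" if "t < length q" for t
    using that by (metis nth_replicate)
  then show "changes q = {}"
    by (auto simp: changes_def)
qed

text \<open>Each masque removes at most one change, and the target word has none.\<close>

lemma card_changes_le:
  assumes "set ts \<subseteq> {0..k}" "length q = k"
    and "fold (\<lambda>t. apply_masque (masque_A k t)) ts q = replicate k False"
  shows "card (changes q) \<le> length ts"
  using assms
proof (induction ts arbitrary: q)
  case Nil
  then show ?case using changes_empty_iff[of q] by simp
next
  case (Cons t ts)
  let ?q = "apply_masque (masque_A k t) q"
  have "t \<le> k" using Cons.prems by simp
  have "changes q \<subseteq> insert t (changes ?q)"
    using changes_apply_masque_A[OF \<open>t \<le> k\<close> Cons.prems(2)] Cons.prems(2)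
    by (auto simp: changes_def)
  then have "card (changes q) \<le> card (insert t (changes ?q))"
    by (intro card_mono) auto
  also have "\<dots> \<le> Suc (card (changes ?q))"
    by (simp add: card_insert_if)
  also have "card (changes ?q) \<le> length ts"
    using Cons \<open>t \<le> k\<close> by (intro Cons.IH) (auto simp: length_apply_masque_A)
  finally show ?case by simp
qed

text \<open>The masque at any change removes this change and creates no other, so the changes can be
  removed one by one in any order.\<close>

lemma masques_A_card_changes:
  assumes "length q = k"
  shows "\<exists>ts. length ts = card (changes q) \<and> set ts \<subseteq> {0..k} \<and>
    fold (\<lambda>t. apply_masque (masque_A k t)) ts q = replicate k False"
  using assms
proof (induction "card (changes q)" arbitrary: q)
  case 0
  then show ?case using changes_empty_iff[of q] by simp
next
  case (Suc c)
  then obtain t where t: "t \<in> changes q"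
    by (metis card.empty ex_in_conv nat.distinct(1))
  then have "t < k" using Suc.prems by (simp add: changes_def)
  let ?q = "apply_masque (masque_A k t) q"
  have "changes ?q = changes q - {t}"
    using changes_apply_masque_A[of t k q] \<open>t < k\<close> Suc.prems t by (auto simp: changes_def)
  then have "c = card (changes ?q)"
    using Suc.hyps(2) t by simp
  moreover have "length ?q = k"
    using \<open>t < k\<close> Suc.prems by (simp add: length_apply_masque_A)
  ultimately obtain ts where "length ts = c" "set ts \<subseteq> {0..k}"
      "fold (\<lambda>t. apply_masque (masque_A k t)) ts ?q = replicate k False"
    using Suc.hyps(1) by metis
  then show ?case
    using Suc.hyps(2) \<open>t < k\<close> by (intro exI[of _ "t # ts"]) auto
qed

lemma min_masques_A_eq_card_changes:
  assumes "length q = k"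
  shows "min_masques_A k q = card (changes q)"
  unfolding min_masques_A_def
  using masques_A_card_changes[OF assms] card_changes_le[OF _ assms]
  by (intro Least_equality) blast+

text \<open>A run is determined by its first position, and these positions are the changes. The run
  starting at 0 is counted because the leading letter 1 differs from the virtual 0.\<close>

lemma card_runs_eq_card_changes:
  assumes "w \<noteq> []" "hd w"
  shows "card (runs w) = card (changes w)"
proof -
  have first: "w ! 0"
    using assms by (simp add: hd_conv_nth)
  have le: "j \<le> j'" if "(i, j) \<in> runs w" "(i, j') \<in> runs w" for i j j'
  proof (rule ccontr)
    assume "\<not> j \<le> j'"
    have *: "i \<le> j'" "j < length w" "\<forall>l \<in> {i..j}. w ! l = w ! i"
        "j' + 1 < length w \<longrightarrow> w ! (j' + 1) \<noteq> w ! j'"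
      using that unfolding runs_def by blast+
    have "j' + 1 \<in> {i..j}" "j' \<in> {i..j}" "j' + 1 < length w"
      using \<open>\<not> j \<le> j'\<close> *(1,2) by simp_all
    then show False using *(3,4) by metis
  qed
  have "inj_on fst (runs w)"
    by (intro inj_onI) (metis antisym le prod.collapse)
  moreover have "fst ` runs w = changes w"
  proof (intro equalityI subsetI)
    fix i assume "i \<in> fst ` runs w"
    then obtain j where "(i, j) \<in> runs w" by auto
    then have "i \<le> j" "j < length w" "0 < i \<longrightarrow> w ! (i - 1) \<noteq> w ! i"
      unfolding runs_def by blast+
    then show "i \<in> changes w"
      using first by (cases "i = 0") (auto simp: changes_def)
  next
    fix i assume i: "i \<in> changes w"
    \<comment> \<open>The run starting at \<open>i\<close> ends at the last position up to which the
      letters stay equal to \<open>w ! i\<close>.\<close>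
    define J where "J = {j. i \<le> j \<and> j < length w \<and> (\<forall>l \<in> {i..j}. w ! l = w ! i)}"
    have "finite J" "i \<in> J"
      using i by (auto simp: J_def changes_def)
    then have "Max J \<in> J"
      by (auto intro: Max_in)
    then have J: "i \<le> Max J" "Max J < length w" "\<forall>l \<in> {i..Max J}. w ! l = w ! i"
      unfolding J_def by blast+
    have "w ! (Max J + 1) \<noteq> w ! Max J" if "Max J + 1 < length w"
    proof
      assume "w ! (Max J + 1) = w ! Max J"
      also have "\<dots> = w ! i" using J(1) by (intro bspec[OF J(3)]) simp
      finally have "w ! l = w ! i" if "l \<in> {i..Max J + 1}" for l
        using that bspec[OF J(3), of l] by (cases "l = Max J + 1") auto
      then have "Max J + 1 \<in> J"
        using J(1) \<open>Max J + 1 < length w\<close> unfolding J_def by (blast intro: le_add1 order_trans)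
      with \<open>finite J\<close> have "Max J + 1 \<le> Max J" by (rule Max_ge)
      then show False by simp
    qed
    moreover have "0 < i \<longrightarrow> w ! (i - 1) \<noteq> w ! i"
      using i by (auto simp: changes_def)
    ultimately have "(i, Max J) \<in> runs w"
      using J unfolding runs_def by blast
    then show "i \<in> fst ` runs w" by force
  qed
  ultimately show ?thesis by (metis card_image)
qed

section \<open>Changes of binary digits of numbers\<close>

text \<open>Here the zeros above the leading digit replace the virtual 0, so numbers with expansions
  of different lengths can be compared.\<close>

definition bit_changes :: "nat \<Rightarrow> nat set" where
  "bit_changes n = {i. bit n i \<noteq> bit n (Suc i)}"

lemma not_bit_ge:
  assumes "n < 2 ^ k" "k \<le> i"
  shows "\<not> bit (n :: nat) i"
proof -
  have "n < 2 ^ i"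
    using assms by (meson less_le_trans one_le_numeral power_increasing)
  then show ?thesis by (simp add: bit_iff_odd)
qed

lemma finite_bit_changes [simp]: "finite (bit_changes n)"
proof -
  have "n < 2 ^ n" by (rule less_exp)
  then have "bit_changes n \<subseteq> {..<n}"
    using not_bit_ge[of n n] by (auto simp: bit_changes_def not_le[symmetric])
  then show ?thesis by (rule finite_subset) simp
qed

text \<open>Words start with the most significant digit, so position \<open>t\<close> corresponds to
  bit \<open>m - t\<close>, and its left neighbour to the next higher bit.\<close>

lemma card_changes_binary_expansion:
  assumes "n > 0"
  shows "card (changes (binary_expansion n)) = card (bit_changes n)"
proof -
  define m where "m = nat \<lfloor>log 2 (real n)\<rfloor>"
  have len: "length (binary_expansion n) = Suc m"
    by (simp add: length_binary_expansion m_def)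
  have "\<lfloor>log 2 (real n)\<rfloor> = int m"
    using assms by (simp add: m_def)
  then have n_less: "n < 2 ^ Suc m"
    using assms floor_log_nat_eq_powr_iff[of 2 n m] by simp
  have nth: "binary_expansion n ! t = bit n (m - t)" if "t \<le> m" for t
    using that by (simp add: binary_expansion_def m_def[symmetric] rev_nth del: upt_Suc)
  have iff: "t \<in> changes (binary_expansion n) \<longleftrightarrow> m - t \<in> bit_changes n" if "t \<le> m" for t
  proof (cases t)
    case 0
    then show ?thesis
      using that nth[of 0] not_bit_ge[OF n_less, of "Suc m"] len
      by (simp add: changes_def bit_changes_def)
  next
    case (Suc u)
    then have "Suc (m - t) = m - u" using that by simp
    then show ?thesis
      using that nth[of t] nth[of u] len Suc by (simp add: changes_def bit_changes_def)
  qed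
  have less: "i \<le> m" if "i \<in> bit_changes n" for i
    using that not_bit_ge[OF n_less, of i] not_bit_ge[OF n_less, of "Suc i"]
    by (auto simp: bit_changes_def not_less_eq_eq[symmetric])
  have less': "t \<le> m" if "t \<in> changes (binary_expansion n)" for t
    using that len by (simp add: changes_def)
  have left: "m - t \<in> bit_changes n" if "t \<in> changes (binary_expansion n)" for t
    using that iff less' by blast
  have right: "m - i \<in> changes (binary_expansion n)" if "i \<in> bit_changes n" for i
    using that iff[of "m - i"] less[OF that] by simp
  have "bij_betw (\<lambda>t. m - t) (changes (binary_expansion n)) (bit_changes n)"
    by (rule bij_betw_byWitness[where f' = "\<lambda>t. m - t"]) (auto simp: less less' left right)
  then show ?thesis by (rule bij_betw_same_card)
qed

text \<open>This is a masque operation on numbers; leading zeros are complemented too, so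
  \<open>a\<close> and \<open>b\<close> may have different lengths.\<close>

definition flip_low_bits :: "nat \<Rightarrow> nat \<Rightarrow> nat \<Rightarrow> bool" where
  "flip_low_bits m a b \<longleftrightarrow> (\<forall>i. bit a i = (if i \<le> m then \<not> bit b i else bit b i))"

lemma flip_low_bits_changes:
  assumes "flip_low_bits m a b"
  shows "i \<in> bit_changes a \<longleftrightarrow> (i \<in> bit_changes b) \<noteq> (i = m)"
  using assms by (auto simp: flip_low_bits_def bit_changes_def not_less_eq_eq)

text \<open>The sum \<open>x + y\<close> consists of \<open>M\<close> binary ones, so the digits of
  \<open>x\<close> and \<open>y\<close> are complementary, as induction from the lowest digit
  shows.\<close>

lemma bit_complement:
  fixes x y :: nat
  assumes "Suc (x + y) = 2 ^ M" "i < M"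
  shows "bit x i \<longleftrightarrow> \<not> bit y i"
  using assms
proof (induction M arbitrary: x y i)
  case (Suc M)
  have odd: "odd (x + y)"
    using Suc.prems(1) by (metis even_Suc even_numeral even_power power_Suc even_mult_iff)
  show ?case
  proof (cases i)
    case 0
    then show ?thesis using odd by (auto simp: bit_0)
  next
    case (Suc j)
    \<comment> \<open>Exactly one of \<open>x\<close> and \<open>y\<close> is odd, so halving both
      loses 1 in total.\<close>
    have "Suc (x div 2 + y div 2) = 2 ^ M"
      using Suc.prems(1) odd by (auto elim!: oddE evenE simp: even_add)
    from Suc.IH[OF this, of j] show ?thesis
      using Suc Suc.prems(2) by (simp add: bit_Suc)
  qed
qed simp

text \<open>The common quotient \<open>q\<close> supplies equal high digits; the remainders are
  complementary.\<close>

lemma flip_low_bitsI: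
  fixes q x y :: nat
  assumes "Suc (x + y) = 2 ^ Suc m"
  shows "flip_low_bits m (2 ^ Suc m * q + x) (2 ^ Suc m * q + y)"
  unfolding flip_low_bits_def
proof
  fix i
  have less: "x < 2 ^ Suc m" "y < 2 ^ Suc m"
    using assms by linarith+
  have low: "bit (2 ^ Suc m * q + z) i = bit z i" if "i \<le> m" "z < 2 ^ Suc m" for z
  proof -
    have "bit (take_bit (Suc m) (2 ^ Suc m * q + z)) i = bit (2 ^ Suc m * q + z) i"
      using that by (simp only: bit_take_bit_iff less_Suc_eq_le simp_thms)
    moreover have "take_bit (Suc m) (2 ^ Suc m * q + z) = z"
      using that by (simp only: take_bit_eq_mod mod_mult_self4 mod_less)
    ultimately show ?thesis by simp
  qed
  have high: "bit (2 ^ Suc m * q + z) i = bit q (i - Suc m)" if "\<not> i \<le> m" "z < 2 ^ Suc m" for z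
  proof -
    have "bit (drop_bit (Suc m) (2 ^ Suc m * q + z)) (i - Suc m) = bit (2 ^ Suc m * q + z) i"
      using that by (simp add: bit_drop_bit_eq)
    moreover have "drop_bit (Suc m) (2 ^ Suc m * q + z) = q"
      using that by (simp only: drop_bit_eq_div div_mult_self4 div_less)
    ultimately show ?thesis by simp
  qed
  show "bit (2 ^ Suc m * q + x) i =
    (if i \<le> m then \<not> bit (2 ^ Suc m * q + y) i else bit (2 ^ Suc m * q + y) i)"
    using low high less bit_complement[OF assms, of i] by (simp add: less_Suc_eq_le)
qed

section \<open>Palindromes in the ruler sequence\<close>

lemma power_dvd_iff_le_ruler: "n > 0 \<Longrightarrow> 2 ^ i dvd n \<longleftrightarrow> i \<le> ruler n"
  unfolding ruler_def by (intro power_dvd_iff_le_multiplicity) auto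

lemma ruler_eqI:
  assumes "x > 0" "y > 0" "\<And>i. 2 ^ i dvd x \<longleftrightarrow> 2 ^ i dvd y"
  shows "ruler x = ruler y"
  using assms by (metis antisym order_refl power_dvd_iff_le_ruler)

text \<open>A power of 2 dividing either number is below \<open>2 ^ M\<close> and hence divides
  \<open>2 ^ M\<close>, so it divides the other number as well. This is the mirror symmetry that
  yields palindromes centred at powers of 2.\<close>

lemma ruler_power2_diff:
  assumes "0 < x" "x < 2 ^ M"
  shows "ruler (2 ^ M - x) = ruler x"
proof (rule ruler_eqI)
  fix i
  show "2 ^ i dvd 2 ^ M - x \<longleftrightarrow> 2 ^ i dvd x"
  proof (cases "i \<le> M")
    case True
    then have "(2 :: nat) ^ i dvd 2 ^ M" by (rule le_imp_power_dvd)
    with assms show ?thesis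
      by (meson dvd_diffD1 dvd_diff_nat less_imp_le)
  next
    case False
    then have "(2 :: nat) ^ M < 2 ^ i" by simp
    with assms have "x < 2 ^ i" "2 ^ M - x < 2 ^ i" "0 < 2 ^ M - x"
      by linarith+
    with assms have "\<not> 2 ^ i dvd x" "\<not> 2 ^ i dvd 2 ^ M - x"
      by (meson nat_dvd_not_less)+
    then show ?thesis by simp
  qed
qed (use assms in auto)

lemma length_factor [simp]: "length (factor x i j) = Suc j - i"
  unfolding factor_def by (simp del: upt_Suc)

lemma palindrome_factor_iff:
  "palindrome (factor x i j) \<longleftrightarrow> (\<forall>l. i \<le> l \<and> l \<le> j \<longrightarrow> x (i + j - l) = x l)"
proof -
  have nth: "factor x i j ! l = x (i + l)" if "l < Suc j - i" for l
    using that by (simp add: factor_def del: upt_Suc)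
  have rev: "rev (factor x i j) ! l = x (j - l)" if "l < Suc j - i" for l
    using that by (simp add: rev_nth nth)
  have "palindrome (factor x i j) \<longleftrightarrow> (\<forall>l < Suc j - i. x (j - l) = x (i + l))"
    by (simp add: palindrome_def list_eq_iff_nth_eq nth rev)
  also have "\<dots> \<longleftrightarrow> (\<forall>l. i \<le> l \<and> l \<le> j \<longrightarrow> x (i + j - l) = x l)"
  proof safe
    fix l assume *: "\<forall>l < Suc j - i. x (j - l) = x (i + l)" "i \<le> l" "l \<le> j"
    then show "x (i + j - l) = x l"
      using *(1)[rule_format, of "l - i"] by (simp add: add.commute)
  next
    fix l assume *: "\<forall>l. i \<le> l \<and> l \<le> j \<longrightarrow> x (i + j - l) = x l" "l < Suc j - i"
    then show "x (j - l) = x (i + l)"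
      using *(1)[rule_format, of "i + l"] by simp
  qed
  finally show ?thesis .
qed

lemma factor_append:
  assumes "i \<le> Suc j" "j \<le> l"
  shows "factor x i l = factor x i j @ factor x (Suc j) l"
  using assms upt_add_eq_append[of i "Suc j" "l - j"]
  by (simp add: factor_def map_append[symmetric] del: map_append upt_Suc)

lemma ruler_palindrome_flip:
  assumes "a < b" and pal: "palindrome (factor ruler (Suc a) b)"
  shows "\<exists>m. flip_low_bits m a b"
proof -
  have sym: "ruler (Suc (a + b) - l) = ruler l" if "a < l" "l \<le> b" for l
    using pal that by (simp add: palindrome_factor_iff)
  have even_iff: "even l \<longleftrightarrow> 0 < ruler l" if "l > 0" for l
    using power_dvd_iff_le_ruler[OF that, of 1] by auto
  \<comment> \<open>Otherwise the length is even and the two middle terms are equal, although one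
    index is even and the other odd.\<close>
  have "odd (a + b)"
  proof
    assume "even (a + b)"
    then obtain h where h: "a + b = 2 * h" by blast
    then have "a < h" "h \<le> b" "Suc (a + b) - h = Suc h" using \<open>a < b\<close> by simp_all
    with sym[of h] have "ruler (Suc h) = ruler h" by simp
    with even_iff[of h] even_iff[of "Suc h"] \<open>a < h\<close> show False
      by (cases "ruler h") auto
  qed
  then obtain c where c: "Suc (a + b) = 2 * c" by (metis even_Suc evenE)
  then have "a < c" "c \<le> b" using \<open>a < b\<close> by simp_all
  define m where "m = ruler c"
  have "2 ^ m dvd c" "\<not> 2 ^ Suc m dvd c"
    using power_dvd_iff_le_ruler[of c] \<open>a < c\<close> by (simp_all add: m_def del: power_Suc)
  then obtain s where s: "c = 2 ^ m * s" "odd s"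
    by (metis dvdE dvd_mult_cancel_left mult_dvd_mono dvd_refl power_Suc2)
  then obtain q where q: "s = 2 * q + 1" by (auto elim: oddE)
  have cq: "c = 2 ^ Suc m * q + 2 ^ m"
    by (simp add: s q algebra_simps)
  have "b - c < 2 ^ m"
  proof (rule ccontr)
    assume far: "\<not> b - c < 2 ^ m"
    \<comment> \<open>With radius at least \<open>2 ^ m\<close> the factor would contain both mirror
      images \<open>c - 2 ^ m\<close> and \<open>c + 2 ^ m\<close>. These are
      \<open>2 ^ Suc m\<close> times the consecutive numbers \<open>q\<close> and
      \<open>Suc q\<close>, of which only one is even.\<close>
    have "2 ^ Suc m * Suc q \<le> b" "a < 2 ^ Suc m * Suc q" "a < 2 ^ Suc m * q"
      using far c cq \<open>a < c\<close> \<open>c \<le> b\<close> by simp_all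
    moreover have "Suc (a + b) - 2 ^ Suc m * Suc q = 2 ^ Suc m * q"
      using c cq by simp
    ultimately have "ruler (2 ^ Suc m * q) = ruler (2 ^ Suc m * Suc q)"
      using sym[of "2 ^ Suc m * Suc q"] by metis
    moreover have "0 < 2 ^ Suc m * q" "0 < 2 ^ Suc m * Suc q"
      using \<open>a < 2 ^ Suc m * q\<close> by (linarith, simp)
    ultimately have "2 ^ Suc (Suc m) dvd 2 ^ Suc m * q \<longleftrightarrow> 2 ^ Suc (Suc m) dvd 2 ^ Suc m * Suc q"
      by (simp only: power_dvd_iff_le_ruler)
    moreover have "2 ^ Suc (Suc m) dvd 2 ^ Suc m * z \<longleftrightarrow> even z" for z :: nat
      unfolding power_Suc2[of 2 "Suc m"] by (subst dvd_times_left_cancel_iff) simp_all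
    ultimately show False
      by (metis even_Suc)
  qed
  then obtain r where r: "b = c + r" "r < 2 ^ m"
    using \<open>c \<le> b\<close> by (metis le_add_diff_inverse)
  \<comment> \<open>The palindrome starts at \<open>a + 1 = c - r\<close>, which explains the
    \<open>- 1\<close> in the remainder of \<open>a\<close>.\<close>
  have "a = 2 ^ Suc m * q + (2 ^ m - 1 - r)" "b = 2 ^ Suc m * q + (2 ^ m + r)"
    using r c cq by linarith+
  moreover have "Suc ((2 ^ m - 1 - r) + (2 ^ m + r)) = 2 ^ Suc m"
    using r by simp
  ultimately show ?thesis
    using flip_low_bitsI by metis
qed

section \<open>Palindromic length of prefixes of the ruler sequence\<close>

text \<open>Removing a nonempty last palindrome turns \<open>n\<close> into some
  \<open>a < n\<close> by flipping low bits, which loses at most one change.\<close>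

lemma card_bit_changes_le:
  assumes "\<forall>u \<in> set ws. palindrome u" "concat ws = factor ruler 1 n"
  shows "card (bit_changes n) \<le> length ws"
  using assms
proof (induction ws arbitrary: n rule: rev_induct)
  case Nil
  then have "n = 0" by (simp add: factor_def split: if_splits)
  then show ?case by (simp add: bit_changes_def)
next
  case (snoc u us)
  show ?case
  proof (cases "u = []")
    case True
    then show ?thesis using snoc.IH[of n] snoc.prems by simp
  next
    case False
    define a where "a = n - length u"
    have "length (concat us @ u) = n"
      using snoc.prems(2) by simp
    then have a: "length u = n - a" "length (concat us) = a" "a < n"
      using False by (auto simp: a_def simp flip: length_greater_0_conv)
    have "concat us @ u = factor ruler 1 a @ factor ruler (Suc a) n"
      using snoc.prems(2) factor_append[of 1 a n ruler] a by simp
    then have "concat us = factor ruler 1 a" "u = factor ruler (Suc a) n"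
      using a by (auto simp: append_eq_append_conv)
    then obtain m where m: "flip_low_bits m a n"
      using ruler_palindrome_flip[of a n] snoc.prems(1) a by auto
    have "bit_changes n \<subseteq> insert m (bit_changes a)"
      using flip_low_bits_changes[OF m] by auto
    then have "card (bit_changes n) \<le> card (insert m (bit_changes a))"
      by (intro card_mono) auto
    also have "\<dots> \<le> Suc (card (bit_changes a))"
      by (simp add: card_insert_if)
    also have "card (bit_changes a) \<le> length us"
      using snoc \<open>concat us = factor ruler 1 a\<close> by simp
    finally show ?thesis by simp
  qed
qed

text \<open>A greedy choice from the right attains the bound: each suffix palindrome removes the
  topmost change.\<close>

lemma ruler_factorization_card_bit_changes:
  "\<exists>ws. length ws = card (bit_changes n) \<and> (\<forall>u \<in> set ws. palindrome u) \<and>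
     concat ws = factor ruler 1 n"
proof (induction n rule: less_induct)
  case (less n)
  show ?case
  proof (cases "n = 0")
    case True
    then show ?thesis by (simp add: bit_changes_def factor_def)
  next
    case False
    then obtain m where m: "2 ^ m \<le> n" "n < 2 ^ Suc m"
      using ex_power_ivl1[of 2 n] by auto
    \<comment> \<open>All digits of \<open>n\<close> are complemented, so that \<open>a + 1\<close>
      and \<open>n\<close> are symmetric about \<open>2 ^ m\<close>.\<close>
    define a where "a = 2 ^ Suc m - 1 - n"
    have a: "Suc (a + n) = 2 ^ Suc m" "a < n"
      using m by (simp_all add: a_def)
    have flip: "flip_low_bits m a n"
      using flip_low_bitsI[of a n m 0] a by simp
    have "\<not> bit n (Suc m)"
      using m not_bit_ge[of n "Suc m" "Suc m"] by simp
    moreover have "bit n m"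
    proof -
      have "n div 2 ^ m = 1"
        using m by (intro div_nat_eqI) simp_all
      then show ?thesis by (simp add: bit_iff_odd)
    qed
    ultimately have "m \<in> bit_changes n"
      by (simp add: bit_changes_def)
    then have "bit_changes a = bit_changes n - {m}"
      using flip_low_bits_changes[OF flip] by auto
    then have card: "card (bit_changes n) = Suc (card (bit_changes a))"
      using \<open>m \<in> bit_changes n\<close> by (metis card.remove finite_bit_changes)
    have "ruler (Suc a + n - l) = ruler l" if "Suc a \<le> l" "l \<le> n" for l
    proof -
      have "Suc a + n = 2 ^ Suc m" using a by simp
      moreover have "0 < l" "l < 2 ^ Suc m" using that m by linarith+
      ultimately show ?thesis by (simp only: ruler_power2_diff)
    qed
    then have "palindrome (factor ruler (Suc a) n)"
      by (simp add: palindrome_factor_iff)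
    moreover obtain ws where "length ws = card (bit_changes a)"
        "\<forall>u \<in> set ws. palindrome u" "concat ws = factor ruler 1 a"
      using less.IH[OF \<open>a < n\<close>] by blast
    ultimately show ?thesis
      using card factor_append[of 1 a n ruler] a
      by (intro exI[of _ "ws @ [factor ruler (Suc a) n]"]) auto
  qed
qed

lemma pal_length_ruler: "pal_length (factor ruler 1 n) = card (bit_changes n)"
  unfolding pal_length_def
  using ruler_factorization_card_bit_changes[of n] card_bit_changes_le
  by (intro Least_equality) blast+

theorem theorem1:
  fixes n k :: nat and p :: "bool list"
  assumes "n > 0"
    and "p = binary_expansion n"
    and "k = nat \<lfloor>log 2 (real n)\<rfloor> + 1"
  shows "pal_length (factor ruler 1 n) = min_masques_A k p
       \<and> pal_length (factor ruler 1 n) = binary_runs n"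
proof -
  have "length p = k"
    using assms by (simp add: length_binary_expansion)
  then have "p \<noteq> []"
    using assms(3) by auto
  \<comment> \<open>All three quantities equal \<open>card (bit_changes n)\<close>; counting the
    runs uses that the leading digit is 1.\<close>
  then show ?thesis
    using assms \<open>length p = k\<close> binary_expansion_correct(1)[OF assms(1)]
    by (simp add: pal_length_ruler[simplified] min_masques_A_eq_card_changes binary_runs_def
        card_runs_eq_card_changes card_changes_binary_expansion)
qed

end
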